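(* For every $d\in\mathbb{N}$, all $n_1,\dots,n_d\in\mathbb{N}$ and each real $d$-dimensional array $A=(a_{i_1,\dots,i_d})_{i_k\le n_k,\,1\le k\le d}$, $$ \|A\|_{cut}\le\Bigl\|\sum_{i_1=1}^{n_1}\sum_{i_2=1}^{n_2}\cdots\sum_{i_d=1}^{n_d}a_{i_1,i_2,\dots,i_d}\,r_{i_1}\otimes r_{i_2}\otimes\cdots\otimes r_{i_d}\Bigr\|_{L_\infty([0,1]^d)}\le 2^d\,\|A\|_{cut}. $$
   Context: The Rademacher functions are $r_i(t)=(-1)^{[2^i t]}$, $t\in[0,1]$, $i=1,2,\dots$, where $[x]$ is the integer part of $x$; $(r_{i_1}\otimes\cdots\otimes r_{i_d})(t_1,\dots,t_d)=r_{i_1}(t_1)\cdots r_{i_d}(t_d)$. The cut-norm of the array is $$\|A\|_{cut}:=\max\Bigl\{\Bigl|\sum_{i_1\in I_1}\cdots\sum_{i_d\in I_d}a_{i_1,\dots,i_d}\Bigr|:\ I_k\subset\{1,\dots,n_k\},\ k=1,\dots,d\Bigr\}.$$ *)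

theory Defs
  imports "HOL-Probability.Essential_Supremum"
begin

definition rademacher :: "nat \<Rightarrow> real \<Rightarrow> real" where
  "rademacher i t = (-1) powi \<lfloor>2 ^ i * t\<rfloor>"

text \<open>The points \<open>(t\<^sub>1, \<dots>, t\<^sub>d)\<close> and the multi-indices \<open>(i\<^sub>1, \<dots>, i\<^sub>d)\<close> are extensional
  functions on \<open>{1..d}\<close>.\<close>

definition tensor :: "nat \<Rightarrow> (nat \<Rightarrow> real \<Rightarrow> real) \<Rightarrow> (nat \<Rightarrow> real) \<Rightarrow> real" where
  "tensor d f t = (\<Prod>k\<in>{1..d}. f k (t k))"

definition multi_indices :: "nat \<Rightarrow> (nat \<Rightarrow> nat) \<Rightarrow> (nat \<Rightarrow> nat) set" where
  "multi_indices d n = (\<Pi>\<^sub>E k\<in>{1..d}. {1..n k})"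

text \<open>An array is a function on multi-indices; only its values on \<open>multi_indices d n\<close> matter.\<close>

definition cut_norm :: "nat \<Rightarrow> (nat \<Rightarrow> nat) \<Rightarrow> ((nat \<Rightarrow> nat) \<Rightarrow> real) \<Rightarrow> real" where
  "cut_norm d n a =
     Max ((\<lambda>I. \<bar>\<Sum>i\<in>(\<Pi>\<^sub>E k\<in>{1..d}. I k). a i\<bar>) ` (\<Pi>\<^sub>E k\<in>{1..d}. Pow {1..n k}))"

definition unit_cube :: "nat \<Rightarrow> (nat \<Rightarrow> real) measure" where
  "unit_cube d = (\<Pi>\<^sub>M k\<in>{1..d}. restrict_space lborel {0..1})"

text \<open>By the convention of \<open>esssup\<close>, the value is \<open>\<infinity>\<close> if \<open>\<bar>f\<bar>\<close> is not measurable.\<close>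

definition Linf_norm :: "'a measure \<Rightarrow> ('a \<Rightarrow> real) \<Rightarrow> ereal" where
  "Linf_norm M f = esssup M (\<lambda>x. ereal \<bar>f x\<bar>)"

end

theory Submission
  imports Defs
begin

text \<open>
  Write \<open>F(u\<^sub>1, \<dots>, u\<^sub>d) = \<Sum>\<^sub>i a\<^sub>i u\<^sub>1(i\<^sub>1) \<cdots> u\<^sub>d(i\<^sub>d)\<close> for the multilinear form of the array. The cut-norm is the
  maximum of \<open>\<bar>F\<bar>\<close> over indicator vectors, and the \<open>L\<^sub>\<infinity>\<close> norm of the Rademacher sum is the maximum
  of \<open>\<bar>F\<bar>\<close> over sign vectors: the first \<open>n\<close> Rademacher functions take every pattern of \<open>n\<close> signs on
  some dyadic interval (\<open>rademacher_pattern\<close>), so every family of sign vectors occurs on a box of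
  positive measure and is seen by the essential supremum (\<open>sign_form_le_Linf\<close>).

  It remains to compare the two maxima. Splitting each of the \<open>d\<close> arguments into two summands
  expands \<open>F\<close> into \<open>2\<^sup>d\<close> terms. A sign vector is a difference of two indicators, which gives the
  factor \<open>2\<^sup>d\<close> in the upper bound (\<open>sign_form_le_cut_norm\<close>). An indicator is half the sum of the
  all-ones vector and a sign vector, so its form is an average of \<open>2\<^sup>d\<close> values on sign vectors, and the
  lower bound has constant \<open>1\<close> (\<open>cut_norm_le_sign_form\<close>).
\<close>

section \<open>The multilinear form of an array\<close>

definition array_form ::
    "nat \<Rightarrow> (nat \<Rightarrow> nat) \<Rightarrow> ((nat \<Rightarrow> nat) \<Rightarrow> real) \<Rightarrow> (nat \<Rightarrow> nat \<Rightarrow> real) \<Rightarrow> real" where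
  "array_form d n a u = (\<Sum>i\<in>multi_indices d n. a i * (\<Prod>k\<in>{1..d}. u k (i k)))"

lemma array_form_cong:
  assumes "\<And>k j. k \<in> {1..d} \<Longrightarrow> j \<in> {1..n k} \<Longrightarrow> u k j = v k j"
  shows "array_form d n a u = array_form d n a v"
  unfolding array_form_def
  by (intro sum.cong refl arg_cong[where f = "\<lambda>x. _ * x"] prod.cong)
     (auto simp: multi_indices_def PiE_iff intro!: assms)

lemma array_form_scale:
  "array_form d n a (\<lambda>k j. c k * u k j) = (\<Prod>k\<in>{1..d}. c k) * array_form d n a u"
  by (simp add: array_form_def prod.distrib sum_distrib_left mult_ac)

lemma array_form_add:
  "array_form d n a (\<lambda>k j. v k j + w k j)
     = (\<Sum>B\<in>Pow {1..d}. array_form d n a (\<lambda>k. if k \<in> B then v k else w k))"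
proof -
  have expand: "(\<Prod>k\<in>{1..d}. v k (i k) + w k (i k))
          = (\<Sum>B\<in>Pow {1..d}. \<Prod>k\<in>{1..d}. (if k \<in> B then v k else w k) (i k))" for i
  proof -
    have "(\<Prod>k\<in>B. v k (i k)) * (\<Prod>k\<in>{1..d} - B. w k (i k))
            = (\<Prod>k\<in>{1..d}. (if k \<in> B then v k else w k) (i k))" if "B \<subseteq> {1..d}" for B
    proof -
      have "(\<Prod>k\<in>{1..d}. (if k \<in> B then v k else w k) (i k))
              = (\<Prod>k\<in>{1..d}. if k \<in> B then v k (i k) else w k (i k))"
        by (intro prod.cong) auto
      also have "\<dots> = (\<Prod>k\<in>{1..d} \<inter> {k. k \<in> B}. v k (i k)) * (\<Prod>k\<in>{1..d} \<inter> - {k. k \<in> B}. w k (i k))"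
        by (rule prod.If_cases) simp
      also have "{1..d} \<inter> {k. k \<in> B} = B"
        using that by auto
      also have "{1..d} \<inter> - {k. k \<in> B} = {1..d} - B"
        by auto
      finally show ?thesis by simp
    qed
    then show ?thesis
      by (subst prod_add) (auto intro!: sum.cong)
  qed
  show ?thesis
    unfolding array_form_def expand sum_distrib_left by (rule sum.swap)
qed

lemma array_form_add_bound:
  assumes "\<And>B. B \<subseteq> {1..d} \<Longrightarrow> \<bar>array_form d n a (\<lambda>k. if k \<in> B then v k else w k)\<bar> \<le> M"
  shows "\<bar>array_form d n a (\<lambda>k j. v k j + w k j)\<bar> \<le> 2 ^ d * M"
proof -
  have "\<bar>array_form d n a (\<lambda>k j. v k j + w k j)\<bar>
          \<le> (\<Sum>B\<in>Pow {1..d}. \<bar>array_form d n a (\<lambda>k. if k \<in> B then v k else w k)\<bar>)"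
    unfolding array_form_add by (rule sum_abs)
  also have "\<dots> \<le> of_nat (card (Pow {1..d})) * M"
    by (rule sum_bounded_above) (use assms in auto)
  finally show ?thesis by (simp add: card_Pow)
qed

lemma array_form_indicator:
  assumes "\<And>k. k \<in> {1..d} \<Longrightarrow> I k \<subseteq> {1..n k}"
  shows "array_form d n a (\<lambda>k. indicator (I k)) = (\<Sum>i\<in>(\<Pi>\<^sub>E k\<in>{1..d}. I k). a i)"
proof -
  have "(\<Sum>i\<in>(\<Pi>\<^sub>E k\<in>{1..d}. I k). a i)
          = (\<Sum>i\<in>multi_indices d n. a i * (\<Prod>k\<in>{1..d}. indicator (I k) (i k)))"
  proof (rule sum.mono_neutral_cong_left)
    show "finite (multi_indices d n)"
      unfolding multi_indices_def by (intro finite_PiE) auto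
    show "(\<Pi>\<^sub>E k\<in>{1..d}. I k) \<subseteq> multi_indices d n"
      unfolding multi_indices_def by (rule PiE_mono) (use assms in auto)
    show "\<forall>i\<in>multi_indices d n - (\<Pi>\<^sub>E k\<in>{1..d}. I k).
            a i * (\<Prod>k\<in>{1..d}. indicator (I k) (i k)) = 0"
    proof
      fix i assume "i \<in> multi_indices d n - (\<Pi>\<^sub>E k\<in>{1..d}. I k)"
      then obtain k where "k \<in> {1..d}" "i k \<notin> I k"
        by (auto simp: multi_indices_def PiE_iff)
      then show "a i * (\<Prod>k\<in>{1..d}. indicator (I k) (i k)) = 0"
        by (auto simp: indicator_def)
    qed
    show "a i = a i * (\<Prod>k\<in>{1..d}. indicator (I k) (i k))" if "i \<in> (\<Pi>\<^sub>E k\<in>{1..d}. I k)" for i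
      using that by (auto simp: PiE_iff)
  qed
  then show ?thesis by (simp add: array_form_def)
qed

section \<open>Indicator vectors against sign vectors\<close>

lemma finite_cut_values:
  "finite ((\<lambda>I. \<bar>\<Sum>i\<in>(\<Pi>\<^sub>E k\<in>{1..d}. I k). a i\<bar>) ` (\<Pi>\<^sub>E k\<in>{1..d}. Pow {1..n k}))"
  for a :: "(nat \<Rightarrow> nat) \<Rightarrow> real"
  by (intro finite_imageI finite_PiE) auto

lemma cut_norm_ge:
  assumes "\<And>k. k \<in> {1..d} \<Longrightarrow> I k \<subseteq> {1..n k}"
  shows "\<bar>array_form d n a (\<lambda>k. indicator (I k))\<bar> \<le> cut_norm d n a"
proof -
  \<comment> \<open>Only extensional families of sets compete in \<open>cut_norm\<close>.\<close>
  define J where "J = restrict I {1..d}"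
  have "J \<in> (\<Pi>\<^sub>E k\<in>{1..d}. Pow {1..n k})"
    using assms by (auto simp: J_def)
  moreover have "(\<Pi>\<^sub>E k\<in>{1..d}. I k) = (\<Pi>\<^sub>E k\<in>{1..d}. J k)"
    by (rule PiE_cong) (simp add: J_def)
  then have "\<bar>array_form d n a (\<lambda>k. indicator (I k))\<bar> = \<bar>\<Sum>i\<in>(\<Pi>\<^sub>E k\<in>{1..d}. J k). a i\<bar>"
    using array_form_indicator[of d I n a] assms by simp
  ultimately show ?thesis
    unfolding cut_norm_def by (intro Max_ge finite_cut_values) (rule image_eqI)
qed

lemma cut_norm_attained:
  obtains I where "\<And>k. k \<in> {1..d} \<Longrightarrow> I k \<subseteq> {1..n k}"
    and "cut_norm d n a = \<bar>array_form d n a (\<lambda>k. indicator (I k))\<bar>"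
proof -
  have "(\<lambda>k\<in>{1..d}. {}) \<in> (\<Pi>\<^sub>E k\<in>{1..d}. Pow {1..n k})" by auto
  then have "cut_norm d n a
      \<in> (\<lambda>I. \<bar>\<Sum>i\<in>(\<Pi>\<^sub>E k\<in>{1..d}. I k). a i\<bar>) ` (\<Pi>\<^sub>E k\<in>{1..d}. Pow {1..n k})"
    unfolding cut_norm_def by (intro Max_in finite_cut_values) blast
  then obtain I where I: "I \<in> (\<Pi>\<^sub>E k\<in>{1..d}. Pow {1..n k})"
    and eq: "cut_norm d n a = \<bar>\<Sum>i\<in>(\<Pi>\<^sub>E k\<in>{1..d}. I k). a i\<bar>"
    by blast
  have "I k \<subseteq> {1..n k}" if "k \<in> {1..d}" for k
    using I that by (auto simp: PiE_iff)
  then show thesis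
    using that[of I] eq array_form_indicator[of d I n a] by simp
qed

text \<open>
  With \<open>e\<^sub>k = 1\<^bsub>{e\<^sub>k = 1}\<^esub> - 1\<^bsub>{e\<^sub>k = -1}\<^esub>\<close>, each term of the expansion is, up to a global sign, the form on
  one family of indicators, hence bounded by the cut-norm.
\<close>
lemma sign_form_le_cut_norm:
  assumes "\<And>k j. e k j \<in> {-1, 1}"
  shows "\<bar>array_form d n a e\<bar> \<le> 2 ^ d * cut_norm d n a"
proof -
  define P where "P s k = {j \<in> {1..n k}. e k j = s}" for s k
  have "array_form d n a e
          = array_form d n a (\<lambda>k j. indicator (P 1 k) j + - indicator (P (-1) k) j)"
    by (rule array_form_cong) (use assms in \<open>auto simp: P_def indicator_def\<close>)
  also have "\<bar>\<dots>\<bar> \<le> 2 ^ d * cut_norm d n a"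
  proof (rule array_form_add_bound)
    fix B :: "nat set"
    define s where "s k = (if k \<in> B then 1 else - 1 :: real)" for k
    have "(\<lambda>k. if k \<in> B then indicator (P 1 k) else (\<lambda>j. - indicator (P (-1) k) j))
            = (\<lambda>k j. s k * indicator (P (s k) k) j)"
      by (auto simp: s_def fun_eq_iff)
    moreover have "\<bar>\<Prod>k\<in>{1..d}. s k\<bar> = 1"
      by (simp add: abs_prod s_def if_distrib cong: if_cong)
    moreover have "\<bar>array_form d n a (\<lambda>k. indicator (P (s k) k))\<bar> \<le> cut_norm d n a"
      by (rule cut_norm_ge) (auto simp: P_def)
    ultimately show "\<bar>array_form d n a
        (\<lambda>k. if k \<in> B then indicator (P 1 k) else (\<lambda>j. - indicator (P (-1) k) j))\<bar>
          \<le> cut_norm d n a"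
      by (simp add: array_form_scale abs_mult)
  qed
  finally show ?thesis .
qed

text \<open>
  The scaling \<open>1\<^bsub>I\<^esub> = (1 + s) / 2\<close> contributes \<open>2\<^bsup>-d\<^esup>\<close>, which cancels the number of terms; all of them
  are forms on sign vectors because the constant \<open>1\<close> is one.
\<close>
lemma cut_norm_le_sign_form:
  assumes bound: "\<And>e. (\<And>k j. e k j \<in> {-1, 1}) \<Longrightarrow> \<bar>array_form d n a e\<bar> \<le> M"
  shows "cut_norm d n a \<le> M"
proof -
  obtain I where I: "\<And>k. k \<in> {1..d} \<Longrightarrow> I k \<subseteq> {1..n k}"
    and eq: "cut_norm d n a = \<bar>array_form d n a (\<lambda>k. indicator (I k))\<bar>"
    by (rule cut_norm_attained[of d n a]) blast
  define s where "s k j = (if j \<in> I k then 1 else - 1 :: real)" for k j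
  have "array_form d n a (\<lambda>k. indicator (I k)) = array_form d n a (\<lambda>k j. 1 / 2 * (1 + s k j))"
    by (rule array_form_cong) (simp add: s_def indicator_def)
  also have "\<dots> = (1 / 2) ^ d * array_form d n a (\<lambda>k j. 1 + s k j)"
    by (subst array_form_scale) simp
  finally have "cut_norm d n a = (1 / 2) ^ d * \<bar>array_form d n a (\<lambda>k j. 1 + s k j)\<bar>"
    using eq by (simp add: abs_mult)
  also have "\<dots> \<le> (1 / 2) ^ d * (2 ^ d * M)"
    by (intro mult_left_mono array_form_add_bound bound) (auto simp: s_def)
  also have "\<dots> = M"
    by (simp add: power_divide)
  finally show ?thesis .
qed

section \<open>Sign patterns of the Rademacher functions\<close>

lemma rademacher_eq: "rademacher i t = (if even \<lfloor>2 ^ i * t\<rfloor> then 1 else - 1)"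
  by (simp add: rademacher_def power_int_minus_one_minus)

lemma borel_measurable_rademacher [measurable]: "rademacher i \<in> borel_measurable borel"
  unfolding rademacher_eq[abs_def] by measurable

text \<open>
  Binary digits: passing from \<open>n\<close> to \<open>n + 1\<close> halves the dyadic interval, and \<open>r\<^bsub>n+1\<^esub>\<close> is \<open>1\<close> on its
  left half and \<open>-1\<close> on its right half. The intervals are half-open because \<open>r\<^sub>i\<close> jumps at their
  right end points.
\<close>
lemma rademacher_pattern:
  assumes "\<And>j. e j \<in> {-1, 1}"
  shows "\<exists>m::nat. m < 2 ^ n \<and>
           (\<forall>t\<in>{real m / 2 ^ n..<(real m + 1) / 2 ^ n}. \<forall>j\<in>{1..n}. rademacher j t = e j)"
proof (induction n)
  case 0
  show ?case by auto
next
  case (Suc n)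
  then obtain m :: nat where m: "m < 2 ^ n"
    and pat: "\<And>t j. t \<in> {real m / 2 ^ n..<(real m + 1) / 2 ^ n} \<Longrightarrow> j \<in> {1..n} \<Longrightarrow> rademacher j t = e j"
    by blast
  define b :: nat where "b = (if e (Suc n) = 1 then 0 else 1)"
  define m' where "m' = 2 * m + b"
  have b: "b \<le> 1" by (simp add: b_def)
  have "m' < 2 ^ Suc n"
    using m b by (simp add: m'_def)
  moreover have "rademacher j t = e j"
    if t: "t \<in> {real m' / 2 ^ Suc n..<(real m' + 1) / 2 ^ Suc n}" and j: "j \<in> {1..Suc n}" for t j
  proof (cases "j = Suc n")
    case True
    have "real m' \<le> 2 ^ Suc n * t" "2 ^ Suc n * t < real m' + 1"
      using t by (auto simp: field_simps)
    then have "\<lfloor>2 ^ Suc n * t\<rfloor> = int m'"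
      by linarith
    then show ?thesis
      using assms[of "Suc n"] True by (auto simp: rademacher_eq m'_def b_def)
  next
    case False
    have "2 * real m \<le> real m'" "real m' + 1 \<le> 2 * (real m + 1)"
      using b by (auto simp: m'_def)
    moreover have "real m' \<le> 2 * (2 ^ n * t)" "2 * (2 ^ n * t) < real m' + 1"
      using t by (auto simp: field_simps)
    ultimately have "real m \<le> 2 ^ n * t" "2 ^ n * t < real m + 1"
      by simp_all
    then have "t \<in> {real m / 2 ^ n..<(real m + 1) / 2 ^ n}"
      by (auto simp: field_simps)
    then show ?thesis
      using pat j False by auto
  qed
  ultimately show ?case by blast
qed

section \<open>The essential supremum over the cube\<close>

lemma emeasure_unit_cube_box_pos:
  assumes "\<And>k. k \<in> {1..d} \<Longrightarrow> 0 \<le> l k \<and> l k < u k \<and> u k \<le> 1"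
  shows "(\<Pi>\<^sub>E k\<in>{1..d}. {l k..<u k}) \<in> sets (unit_cube d)"
    and "emeasure (unit_cube d) (\<Pi>\<^sub>E k\<in>{1..d}. {l k..<u k}) > 0"
proof -
  let ?I = "restrict_space lborel {0..1::real}"
  interpret product_sigma_finite "\<lambda>_::nat. ?I"
    unfolding product_sigma_finite_def
    by (auto intro!: sigma_finite_measure_restrict_space lborel.sigma_finite_measure_axioms)
  have sub: "{l k..<u k} \<subseteq> {0..1}" if "k \<in> {1..d}" for k
    using assms[OF that] by auto
  have sets: "{l k..<u k} \<in> sets ?I" if "k \<in> {1..d}" for k
    using sub[OF that] by (auto simp: sets_restrict_space_iff)
  show "(\<Pi>\<^sub>E k\<in>{1..d}. {l k..<u k}) \<in> sets (unit_cube d)"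
    unfolding unit_cube_def by (rule sets_PiM_I_finite) (use sets in auto)
  have "emeasure ?I {l k..<u k} \<noteq> 0" if "k \<in> {1..d}" for k
    using assms[OF that] sub[OF that] by (simp add: emeasure_restrict_space)
  then have "(\<Prod>k\<in>{1..d}. emeasure ?I {l k..<u k}) \<noteq> 0"
    by (simp add: prod_zero_iff)
  then show "emeasure (unit_cube d) (\<Pi>\<^sub>E k\<in>{1..d}. {l k..<u k}) > 0"
    unfolding unit_cube_def by (subst emeasure_PiM) (use sets in \<open>auto simp: zero_less_iff_neq_zero\<close>)
qed

lemma rademacher_sum_eq_array_form:
  "(\<Sum>i\<in>multi_indices d n. a i * tensor d (\<lambda>k. rademacher (i k)) t)
     = array_form d n a (\<lambda>k j. rademacher j (t k))"
  by (simp add: array_form_def tensor_def)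

text \<open>
  The Rademacher sum is constant, equal to the form on \<open>e\<close>, on a product of dyadic intervals, and a
  value taken on a set of positive measure cannot exceed the essential supremum.
\<close>
lemma sign_form_le_Linf:
  assumes "\<And>k j. e k j \<in> {-1, 1}"
  shows "ereal \<bar>array_form d n a e\<bar>
           \<le> Linf_norm (unit_cube d) (\<lambda>t. array_form d n a (\<lambda>k j. rademacher j (t k)))"
    (is "_ \<le> ?L")
proof -
  have "\<forall>k. \<exists>m::nat. m < 2 ^ n k \<and>
          (\<forall>t\<in>{real m / 2 ^ n k..<(real m + 1) / 2 ^ n k}. \<forall>j\<in>{1..n k}. rademacher j t = e k j)"
    using rademacher_pattern[of "e _"] assms by blast
  then obtain m :: "nat \<Rightarrow> nat" where m: "\<And>k. m k < 2 ^ n k"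
    and pat: "\<And>k t j. t \<in> {real (m k) / 2 ^ n k..<(real (m k) + 1) / 2 ^ n k} \<Longrightarrow> j \<in> {1..n k}
                \<Longrightarrow> rademacher j t = e k j"
    by metis
  define Q where "Q = (\<Pi>\<^sub>E k\<in>{1..d}. {real (m k) / 2 ^ n k..<(real (m k) + 1) / 2 ^ n k})"
  have "real (m k) + 1 \<le> 2 ^ n k" for k
    using m[of k] by (metis Suc_leI of_nat_Suc of_nat_le_iff of_nat_numeral of_nat_power add.commute)
  then have box: "0 \<le> real (m k) / 2 ^ n k \<and> real (m k) / 2 ^ n k < (real (m k) + 1) / 2 ^ n k
               \<and> (real (m k) + 1) / 2 ^ n k \<le> 1" for k
    by (simp add: divide_strict_right_mono)
  have Q: "Q \<in> sets (unit_cube d)" "emeasure (unit_cube d) Q > 0"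
    unfolding Q_def by (rule emeasure_unit_cube_box_pos, use box in blast)+
  have "AE t in unit_cube d. ereal \<bar>array_form d n a (\<lambda>k j. rademacher j (t k))\<bar> \<le> ?L"
    unfolding Linf_norm_def by (rule esssup_AE)
  \<comment> \<open>A property that holds almost everywhere holds somewhere on the non-null box \<open>Q\<close>.\<close>
  moreover have "\<not> (AE t in unit_cube d. t \<notin> Q)"
    using Q AE_iff_measurable[OF Q(1), of "\<lambda>t. t \<notin> Q"] sets.sets_into_space[OF Q(1)]
    by (auto simp: Int_absorb1 Collect_conj_eq)
  ultimately obtain t where t: "t \<in> Q"
    and le: "ereal \<bar>array_form d n a (\<lambda>k j. rademacher j (t k))\<bar> \<le> ?L"
    by (metis (mono_tags, lifting) eventually_mono)
  have "array_form d n a (\<lambda>k j. rademacher j (t k)) = array_form d n a e"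
    by (rule array_form_cong) (use t in \<open>auto simp: Q_def PiE_iff intro!: pat\<close>)
  then show ?thesis
    using le by simp
qed

lemma borel_measurable_rademacher_form:
  "(\<lambda>t. array_form d n a (\<lambda>k j. rademacher j (t k))) \<in> borel_measurable (unit_cube d)"
proof -
  have coord: "(\<lambda>t. t k) \<in> borel_measurable (unit_cube d)" if "k \<in> {1..d}" for k
    unfolding unit_cube_def
    by (rule measurable_compose[OF measurable_component_singleton[OF that]])
       (auto intro!: measurable_restrict_space1)
  show ?thesis
    unfolding array_form_def
    by (intro borel_measurable_sum borel_measurable_times borel_measurable_const
          borel_measurable_prod measurable_compose[OF coord borel_measurable_rademacher])
qed

theorem mainTheorem9:
  fixes d :: nat and n :: "nat \<Rightarrow> nat" and a :: "(nat \<Rightarrow> nat) \<Rightarrow> real"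
  assumes "d \<ge> 1"
    and "\<And>k. k \<in> {1..d} \<Longrightarrow> n k \<ge> 1"
  shows "ereal (cut_norm d n a)
           \<le> Linf_norm (unit_cube d)
               (\<lambda>t. \<Sum>i\<in>multi_indices d n. a i * tensor d (\<lambda>k. rademacher (i k)) t)
       \<and> Linf_norm (unit_cube d)
               (\<lambda>t. \<Sum>i\<in>multi_indices d n. a i * tensor d (\<lambda>k. rademacher (i k)) t)
           \<le> ereal (2 ^ d * cut_norm d n a)"
proof -
  let ?L = "Linf_norm (unit_cube d) (\<lambda>t. array_form d n a (\<lambda>k j. rademacher j (t k)))"
  have upper: "?L \<le> ereal (2 ^ d * cut_norm d n a)"
    unfolding Linf_norm_def
  proof (rule esssup_I)
    show "(\<lambda>t. ereal \<bar>array_form d n a (\<lambda>k j. rademacher j (t k))\<bar>)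
            \<in> borel_measurable (unit_cube d)"
      using borel_measurable_rademacher_form[of d n a] by simp
    show "AE t in unit_cube d. ereal \<bar>array_form d n a (\<lambda>k j. rademacher j (t k))\<bar>
            \<le> ereal (2 ^ d * cut_norm d n a)"
      by (intro AE_I2) (simp, rule sign_form_le_cut_norm, simp add: rademacher_eq)
  qed
  have lower: "ereal (cut_norm d n a) \<le> ?L"
  proof (cases ?L)
    case (real r)
    have "cut_norm d n a \<le> r"
      by (rule cut_norm_le_sign_form)
         (use sign_form_le_Linf[of _ d n a] in \<open>simp add: real\<close>)
    then show ?thesis by (simp add: real)
  next
    case PInf
    then show ?thesis by simp
  next
    case MInf
    \<comment> \<open>Impossible: the norm dominates the absolute value of the form on the all-ones vectors.\<close>
    then show ?thesis
      using sign_form_le_Linf[of "\<lambda>_ _. 1" d n a] by simp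
  qed
  show ?thesis
    unfolding rademacher_sum_eq_array_form using lower upper by blast
qed

end
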